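(* Let $Q$ be an odd prime power. Then: (a) $F_6(X):=X-\mathrm{Tr}_{Q^4/Q^2}(X^{Q^3+Q^2-Q})$ permutes $\mathbb{F}_{Q^4}$; (b) for any nonsquare $\nu\in\mathbb{F}_{Q^2}$, the function $x\mapsto \dfrac{x^{Q+2}+3\nu x^Q-4\nu^{(Q+1)/2}x}{x^2-\nu}$ permutes $\mathbb{F}_{Q^2}$; (c) $\dfrac{X^{2Q+1}-X^{Q+1}+1}{X^{2Q+1}-X^{Q}+1}$ permutes the set of $(Q^2+1)$-th roots of unity in $\mathbb{F}_{Q^4}^*$.
   Context: $\mathrm{Tr}_{Q^4/Q^2}(X)$ denotes the polynomial $X^{Q^2}+X$. "Permutes" means the induced map on the given set is well-defined and bijective. *)

theory Defs
  imports
    "HOL-Computational_Algebra.Computational_Algebra"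
    "HOL-Number_Theory.Prime_Powers"
    "HOL-Library.Cardinality"
begin

definition trace_poly :: "nat \<Rightarrow> 'a::comm_ring_1 poly" where
  "trace_poly Q = monom 1 (Q ^ 2) + monom 1 1"

text \<open>The exponent \<open>Q\<^sup>3 + Q\<^sup>2 - Q\<close> is a natural number since \<open>Q \<le> Q\<^sup>2\<close>, so the subtraction
  does not truncate.\<close>

definition F6 :: "nat \<Rightarrow> 'a::comm_ring_1 poly" where
  "F6 Q = monom 1 1 - pcompose (trace_poly Q) (monom 1 (Q ^ 3 + Q ^ 2 - Q))"

text \<open>The function \<open>x \<mapsto> g x / h x\<close> permutes \<open>S\<close>. As \<open>a / 0 = 0\<close> in HOL, well-definedness of the
  quotient has to be required separately from bijectivity.\<close>

definition quotient_permutes :: "('a::field \<Rightarrow> 'a) \<Rightarrow> ('a \<Rightarrow> 'a) \<Rightarrow> 'a set \<Rightarrow> bool" where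
  "quotient_permutes g h S \<longleftrightarrow>
     (\<forall>x\<in>S. h x \<noteq> 0) \<and> bij_betw (\<lambda>x. g x / h x) S S"

end

theory Submission
  imports Defs
begin

text \<open>
  Write \<open>b\<close> for the \<open>Q\<close>-th power map. \<open>F\<^sub>6\<close> changes \<open>x\<close> by an element fixed by \<open>b\<^sup>2\<close>, so it
  preserves \<open>v = (x - b\<^sup>2 x) / 2\<close>; with \<open>u = x - v\<close>, for \<open>v \<noteq> 0\<close> it sends
  \<open>u + v\<close> to \<open>v - f (b u)\<close>, where \<open>f\<close> is the function in (b) for \<open>\<nu> = (b v)\<^sup>2\<close>. So (a) follows from
  injectivity of \<open>f\<close>. Since \<open>F\<^sub>6\<close> is homogeneous over the fixed field of \<open>b\<^sup>2\<close>, it descends to the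
  quotients \<open>b\<^sup>2 x / x\<close>, which by Hilbert 90 are exactly the \<open>(Q\<^sup>2 + 1)\<close>-th roots of unity; the
  induced map is (c).

  For (b), suppose that \<open>k - d\<close> and \<open>k + d\<close> have the same image, with \<open>d \<noteq> 0\<close>. Eliminating the
  product \<open>k \<cdot> b k\<close> between the resulting equation and its conjugate gives a difference of two
  squares whose two factors are conjugate up to a unit; hence both vanish. This determines
  \<open>(k / d)\<^sup>2\<close>, which turns out to be the square of an explicit element, so \<open>k / d\<close> is known up to
  sign. The norm of \<open>k / d\<close> computed from it is the negative of the one required by the equation,
  so both are zero, which is impossible.
\<close>

text \<open>Moves an equality of two fractions to new coordinates: the numerators share the factor
  \<open>c\<close>, the denominators \<open>c'\<close>, and both cancel.\<close>

lemma cross_mult_rescale: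
  fixes a :: "'a::field"
  assumes "p * a = c * A" "p * b = c * B" "p * a' = c' * A'" "p * b' = c' * B'"
    and "a * b' = b * a'" and "c \<noteq> 0" "c' \<noteq> 0"
  shows "A * B' = B * A'"
proof -
  have "(c * c') * (A * B') = (p * a) * (p * b')"
    using assms(1,4) by algebra
  also have "\<dots> = (p * b) * (p * a')"
    using assms(5) by algebra
  also have "\<dots> = (c * c') * (B * A')"
    using assms(2,3) by algebra
  finally show ?thesis
    using assms(6,7) by simp
qed

section \<open>Field endomorphisms and injectivity of the function in (b)\<close>

locale field_endomorphism =
  fixes bar :: "'a::field \<Rightarrow> 'a"
  assumes bar_add [simp]: "bar (x + y) = bar x + bar y"
    and bar_mult [simp]: "bar (x * y) = bar x * bar y"
    and bar_1 [simp]: "bar 1 = 1"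
    and two_neq_0: "(2::'a) \<noteq> 0"
begin

lemma bar_0 [simp]: "bar 0 = 0"
  using bar_add[of 0 0] by (metis add_cancel_right_right)

lemma bar_minus [simp]: "bar (- x) = - bar x"
  using bar_add[of x "- x"] by (simp del: bar_add add: add_eq_0_iff)

lemma bar_diff [simp]: "bar (x - y) = bar x - bar y"
  using bar_add[of x "- y"] by (simp del: bar_add)

lemma bar_power [simp]: "bar (x ^ n) = bar x ^ n"
  by (induction n) simp_all

lemma bar_of_nat [simp]: "bar (of_nat n) = of_nat n"
  by (induction n) simp_all

lemma bar_numeral [simp]: "bar (numeral n) = numeral n"
  using bar_of_nat[of "numeral n"] by (simp del: bar_of_nat)

lemma bar_eq_0_iff [simp]: "bar x = 0 \<longleftrightarrow> x = 0"
proof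
  assume "bar x = 0"
  then have "bar (x * inverse x) = 0"
    by simp
  then show "x = 0"
    by (cases "x = 0") auto
qed simp

lemma bar_divide [simp]: "bar (x / y) = bar x / bar y"
proof (cases "y = 0")
  case False
  then have "bar (x / y) * bar y = bar x"
    by (simp flip: bar_mult)
  with False show ?thesis
    by (simp add: eq_divide_eq)
qed simp

lemma four_neq_0: "(4::'a) \<noteq> 0"
proof -
  have "(4::'a) = 2 * 2"
    by simp
  with two_neq_0 show ?thesis
    by (metis mult_eq_0_iff)
qed

lemma half_sum_diff: "(a + b) / 2 + (a - b) / 2 = a" "(a + b) / 2 - (a - b) / 2 = (b::'a)"
  using two_neq_0 by (simp_all flip: add_divide_distrib diff_divide_distrib mult_2)

text \<open>The collision of \<open>d (G - 1)\<close> and \<open>d (G + 1)\<close> under the function in (b), in coordinates in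
  which \<open>d\<close>, \<open>\<nu>\<close> and \<open>\<mu> = \<nu>\<^bsup>(Q+1)/2\<^esup>\<close> enter only through \<open>P = d \<cdot> bar d / \<mu>\<close> and
  \<open>\<rho> = \<nu> \<cdot> bar d / (\<mu> d)\<close>.\<close>

lemma no_twisted_collision:
  assumes rk: "\<rho> * \<kappa> = 1" and rho: "bar \<rho> = - \<kappa>" and kappa: "bar \<kappa> = - \<rho>"
    and P: "bar P = - P" "P \<noteq> 0" and G: "bar G = H" and H: "bar H = G"
    and eq: "(P*(G-1)^2*(H-1) + 3*\<rho>*(H-1) - 4*(G-1)) * (P*(G+1)^2 - \<rho>) =
             (P*(G+1)^2*(H+1) + 3*\<rho>*(H+1) - 4*(G+1)) * (P*(G-1)^2 - \<rho>)"
  shows False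
proof -
  define A where "A = \<kappa>*P*(G^2-1) + 1"
  define B where "B = \<rho>*P*(H^2-1) + 1"
  define T where "T = \<rho> - \<kappa> + 4"
  have nz: "\<rho> \<noteq> 0" "\<kappa> \<noteq> 0"
    using rk by auto
  have bar_A: "bar A = B" and bar_B: "bar B = A" and bar_T: "bar T = T"
    by (simp_all add: A_def B_def T_def rho kappa P G H)
  have A': "\<rho> * A = P*(G^2-1) + \<rho>"
    using rk unfolding A_def by algebra
  \<comment> \<open>Replacing \<open>P*(G^2-1)\<close> by \<open>\<rho>*(A-1)\<close> leaves
    \<open>G\<close> and \<open>H\<close> only in the product \<open>G*H\<close>.\<close>
  have "2 * \<rho> * (\<rho>*(A^2-4) + 4*P - 8*G*H*P + 4*A) = 0"
    using eq A' rk by algebra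
  then have E1: "\<rho>*(A^2-4) + 4*P - 8*G*H*P + 4*A = 0"
    using nz two_neq_0 by simp
  then have "bar (\<rho>*(A^2-4) + 4*P - 8*G*H*P + 4*A) = 0"
    by simp
  then have E2: "- \<kappa>*(B^2-4) - 4*P + 8*G*H*P + 4*B = 0"
    by (simp add: rho P G H bar_A mult_ac)
  \<comment> \<open>Eliminating \<open>G * H\<close> from \<open>E1\<close> and \<open>E2\<close> leaves \<open>(\<rho>*A + 2)\<^sup>2 = (B - 2*\<rho>)\<^sup>2\<close>.\<close>
  define F1 where "F1 = \<rho>*A + 2 - B + 2*\<rho>"
  define F2 where "F2 = \<rho>*A + 2 + B - 2*\<rho>"
  have "F1 * F2 = 0"
    using E1 E2 rk unfolding F1_def F2_def by algebra
  moreover have "bar F1 = - \<kappa> * F2"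
  proof -
    have "bar F1 = - \<kappa>*B + 2 - A - 2*\<kappa>"
      by (simp add: F1_def rho bar_A bar_B)
    with rk show ?thesis unfolding F2_def by algebra
  qed
  moreover have "bar F2 = \<kappa> * F1"
  proof -
    have "bar F2 = - \<kappa>*B + 2 + A + 2*\<kappa>"
      by (simp add: F2_def rho bar_A bar_B)
    with rk show ?thesis unfolding F1_def by algebra
  qed
  ultimately have "F1 = 0" "F2 = 0"
    using nz by auto
  then have "2 * (\<rho>*A + 2) = 0" "2 * (B - 2*\<rho>) = 0"
    unfolding F1_def F2_def by algebra+
  then have "\<rho>*A + 2 = 0" "B - 2*\<rho> = 0"
    using two_neq_0 by (metis mult_eq_0_iff)+
  then have B2: "B = 2*\<rho>"
    by simp
  have "A + 2*\<kappa> = \<kappa> * (\<rho>*A + 2) - A * (\<rho>*\<kappa> - 1)"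
    by (simp add: algebra_simps)
  then have "A + 2*\<kappa> = 0"
    using \<open>\<rho>*A + 2 = 0\<close> rk by simp
  then have A2: "A = - (2*\<kappa>)"
    by (simp add: add_eq_0_iff2)
  have PG: "P*G^2 = P - 2 - \<rho>"
    using A2 rk unfolding A_def by algebra
  have PH: "P*H^2 = P + 2 - \<kappa>"
    using B2 rk unfolding B_def by algebra
  have "4 * (P - \<rho> - \<kappa> - 2*G*H*P) = 0"
    using E1 A2 rk by algebra
  then have "P - \<rho> - \<kappa> - 2*G*H*P = 0"
    using four_neq_0 by (metis mult_eq_0_iff)
  then have GH: "2*G*H*P = P - \<rho> - \<kappa>"
    by simp
  \<comment> \<open>Square \<open>GH\<close> and insert \<open>PG\<close> and
    \<open>PH\<close>.\<close>
  have T2: "T^2 = 3*P^2 - 2*P*(\<rho> + \<kappa>)"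
    using GH PG PH rk unfolding T_def by algebra
  have "(2*P*G)^2 = (T - P)^2"
    using T2 PG rk unfolding T_def by algebra
  then have "2*P*G = T - P \<or> 2*P*G = - (T - P)"
    by (simp only: power2_eq_iff)
  \<comment> \<open>A sign fixed by \<open>bar\<close> treats both cases at once and survives
    conjugation.\<close>
  then obtain \<eta> where eta: "2*P*G = \<eta> * (T - P)" "bar \<eta> = \<eta>" "\<eta>^2 = 1"
    using that[of 1] that[of "- 1"] by auto
  have "bar (2*P*G) = bar (\<eta> * (T - P))"
    using eta(1) by simp
  then have eta': "- 2*P*H = \<eta> * (T + P)"
    by (simp add: P G bar_T eta(2))
  \<comment> \<open>Multiplying \<open>eta(1)\<close> by \<open>eta'\<close> gives
    \<open>T^2 - P^2 = -4*P^2*G*H\<close>. By \<open>T2\<close> the left side is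
    \<open>2*P*(P - \<rho> - \<kappa>)\<close>, by \<open>GH\<close> the right side is its
    negative.\<close>
  have "4 * P * (P - \<rho> - \<kappa>) = 0"
    using eta(1,3) eta' GH T2 by algebra
  then have "P - \<rho> - \<kappa> = 0"
    using P four_neq_0 by (metis mult_eq_0_iff)
  then have "G * H = 0"
    using GH P two_neq_0 by simp
  then have "G = 0" "H = 0"
    using G H by auto
  then have "2 * P = 0"
    using eta(1,3) eta' by algebra
  then show False
    using P two_neq_0 by simp
qed

text \<open>Only the elements involved are assumed fixed by \<open>bar\<close> applied twice, so the
  result serves both (b) and the fixed subfield needed for (a). Dividing the midpoint and
  half-difference of \<open>x\<close> and \<open>y\<close> reduces it to
  \<open>no_twisted_collision\<close>.\<close>

lemma twisted_cubic_injective: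
  assumes x: "bar (bar x) = x" and y: "bar (bar y) = y"
    and nu: "bar (bar \<nu>) = \<nu>" "\<nu> \<noteq> 0"
    and mu: "\<mu>^2 = \<nu> * bar \<nu>" "bar \<mu> = - \<mu>"
    and den: "x^2 \<noteq> \<nu>" "y^2 \<noteq> \<nu>"
    and eq: "(x^2 * bar x + 3*\<nu>*bar x - 4*\<mu>*x) / (x^2 - \<nu>) =
             (y^2 * bar y + 3*\<nu>*bar y - 4*\<mu>*y) / (y^2 - \<nu>)"
  shows "x = y"
proof (rule ccontr)
  assume "x \<noteq> y"
  define d where "d = (y - x) / 2"
  define k where "k = (x + y) / 2"
  define e where "e = bar d"
  define l where "l = bar k"
  have d0: "d \<noteq> 0"
    using \<open>x \<noteq> y\<close> two_neq_0 by (simp add: d_def)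
  then have e0: "e \<noteq> 0"
    by (simp add: e_def)
  have bar_e: "bar e = d" and bar_l: "bar l = k"
    by (simp_all add: e_def d_def l_def k_def x y)
  have mu0: "\<mu> \<noteq> 0"
    using mu(1) nu(2) by auto
  define \<rho> where "\<rho> = e * \<nu> / (d * \<mu>)"
  define \<kappa> where "\<kappa> = d * \<mu> / (e * \<nu>)"
  define P where "P = d * e / \<mu>"
  define G where "G = k / d"
  define H where "H = l / e"
  have xy: "x = d*(G-1)" "y = d*(G+1)"
    using d0 half_sum_diff[of y x]
    by (simp_all add: G_def right_diff_distrib distrib_left) (simp_all add: d_def k_def add.commute)
  have bxy: "bar x = e*(H-1)" "bar y = e*(H+1)"
    using e0 by (simp_all add: xy G_def H_def e_def l_def)
  have Pnu: "P * \<nu> = d^2 * \<rho>" and Pmu: "P * \<mu> = d * e"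
    using d0 mu0 by (simp_all add: P_def \<rho>_def field_simps power2_eq_square)
  have P0: "P \<noteq> 0"
    using d0 e0 mu0 by (simp add: P_def)
  have rk: "\<rho> * \<kappa> = 1"
    using d0 e0 mu0 nu by (simp add: \<rho>_def \<kappa>_def)
  have "bar \<rho> = - \<kappa>"
    using mu d0 e0 mu0 nu
    by (simp add: \<rho>_def \<kappa>_def bar_e flip: e_def) (simp add: field_simps power2_eq_square)
  moreover from this have "bar \<kappa> = - \<rho>"
  proof -
    have "bar (\<rho> * \<kappa>) = 1"
      by (simp only: rk bar_1)
    with \<open>bar \<rho> = - \<kappa>\<close> have "- \<kappa> * bar \<kappa> = 1"
      by simp
    with rk show ?thesis by algebra
  qed
  moreover have "bar P = - P"
    by (simp add: P_def bar_e mu flip: e_def)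
  moreover have "bar G = H" "bar H = G"
    by (simp_all add: G_def H_def bar_e bar_l flip: e_def l_def)
  moreover have "(P*(G-1)^2*(H-1) + 3*\<rho>*(H-1) - 4*(G-1)) * (P*(G+1)^2 - \<rho>) =
                 (P*(G+1)^2*(H+1) + 3*\<rho>*(H+1) - 4*(G+1)) * (P*(G-1)^2 - \<rho>)"
    (is "?N1 * ?D2 = ?N2 * ?D1")
  proof -
    have "P * (x^2 * bar x + 3*\<nu>*bar x - 4*\<mu>*x) = d^2 * e * ?N1"
      using Pnu Pmu unfolding bxy unfolding xy by algebra
    moreover have "P * (y^2 * bar y + 3*\<nu>*bar y - 4*\<mu>*y) = d^2 * e * ?N2"
      using Pnu Pmu unfolding bxy unfolding xy by algebra
    moreover have "P * (x^2 - \<nu>) = d^2 * ?D1"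
      using Pnu unfolding xy by algebra
    moreover have "P * (y^2 - \<nu>) = d^2 * ?D2"
      using Pnu unfolding xy by algebra
    moreover have "(x^2 * bar x + 3*\<nu>*bar x - 4*\<mu>*x) * (y^2 - \<nu>) =
             (y^2 * bar y + 3*\<nu>*bar y - 4*\<mu>*y) * (x^2 - \<nu>)"
      using eq den by (simp add: frac_eq_eq)
    ultimately show ?thesis
      by (rule cross_mult_rescale) (use d0 e0 in simp_all)
  qed
  ultimately show False
    using no_twisted_collision[OF rk] P0 by blast
qed

end

section \<open>The map of (a) and its descent to the unit circle in (c)\<close>

locale quartic_automorphism = field_endomorphism +
  assumes bar4 [simp]: "bar (bar (bar (bar x))) = x"
begin

text \<open>On the field with \<open>Q\<^sup>4\<close> elements this is \<open>F\<^sub>6\<close>, also at \<open>0\<close> because \<open>a / 0 = 0\<close>.\<close>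

definition \<Phi> :: "'a \<Rightarrow> 'a" where
  "\<Phi> x = x - (bar (bar x) * bar (bar (bar x)) / bar x + x * bar x / bar (bar (bar x)))"

lemma \<Phi>_0 [simp]: "\<Phi> 0 = 0"
  by (simp add: \<Phi>_def)

text \<open>Applying \<open>bar\<close> twice interchanges the two subtracted summands.\<close>

lemma bar2_\<Phi>: "bar (bar (\<Phi> x)) = bar (bar x) - x + \<Phi> x"
  by (simp add: \<Phi>_def)

lemma \<Phi>_scale:
  assumes "bar (bar c) = c"
  shows "\<Phi> (c * x) = c * \<Phi> x"
  by (cases "c = 0") (simp_all add: \<Phi>_def assms algebra_simps)

lemma \<Phi>_fixed:
  assumes "bar (bar x) = x"
  shows "\<Phi> x = - x"
  using assms by (cases "x = 0") (simp_all add: \<Phi>_def)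

text \<open>Successive applications of \<open>bar\<close> send \<open>u + v\<close> to
  \<open>X + V\<close>, \<open>u - v\<close> and \<open>X - V\<close>, so the two summands have
  common denominator \<open>X^2 - V^2\<close>.\<close>

lemma \<Phi>_decomposition:
  assumes v: "bar (bar v) = - v" "v \<noteq> 0" and u: "bar (bar u) = u"
  defines "X \<equiv> bar u" and "V \<equiv> bar v"
  shows "X^2 \<noteq> V^2"
    and "\<Phi> (u + v) = v - (X^2 * bar X + 3*V^2*bar X - 4*(V * bar V)*X) / (X^2 - V^2)"
proof -
  have bb: "bar X = u" "bar V = - v"
    using u v by (simp_all add: X_def V_def)
  \<comment> \<open>Applying \<open>bar\<close> twice fixes \<open>X\<close> and negates the nonzero
    \<open>V\<close>.\<close>
  have "X \<noteq> V \<and> X \<noteq> - V"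
  proof (rule ccontr)
    assume "\<not> ?thesis"
    then have "bar (bar X) = X \<longleftrightarrow> bar (bar V) = V"
      by auto
    then have "V = - V"
      using bb by (simp add: X_def V_def)
    then have "2 * V = 0"
      by (simp add: eq_neg_iff_add_eq_0)
    then have "V = 0"
      using two_neq_0 by simp
    with v show False
      by (simp add: V_def)
  qed
  then show neq: "X^2 \<noteq> V^2"
    by (simp add: power2_eq_iff)
  from \<open>X \<noteq> V \<and> X \<noteq> - V\<close> have nz: "X + V \<noteq> 0" "X - V \<noteq> 0"
    by (simp_all add: add_eq_0_iff2)
  have sq: "X^2 - V^2 = (X + V) * (X - V)"
    by (simp add: algebra_simps power2_eq_square)
  have "\<Phi> (u + v) = u + v - ((u - v) * (X - V) / (X + V) + (u + v) * (X + V) / (X - V))"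
    using u v bb by (simp add: \<Phi>_def flip: X_def V_def)
  also have "\<dots> = v - (X^2 * u + 3*V^2*u - 4*(V * - v)*X) / (X^2 - V^2)"
    unfolding sq using nz by (simp add: divide_simps) algebra
  finally show "\<Phi> (u + v) = v - (X^2 * bar X + 3*V^2*bar X - 4*(V * bar V)*X) / (X^2 - V^2)"
    by (simp add: bb)
qed

lemma \<Phi>_injective:
  assumes eq: "\<Phi> x = \<Phi> y"
  shows "x = y"
proof -
  define v where "v = (x - bar (bar x)) / 2"
  define u where "u = (x + bar (bar x)) / 2"
  define w where "w = (y + bar (bar y)) / 2"
  have "x - bar (bar x) = y - bar (bar y)"
    using bar2_\<Phi>[of x] bar2_\<Phi>[of y] eq by (simp add: algebra_simps)
  then have v': "v = (y - bar (bar y)) / 2"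
    by (simp add: v_def)
  have xy: "x = u + v" "y = w + v"
    using half_sum_diff(1)[of x "bar (bar x)"] half_sum_diff(1)[of y "bar (bar y)"]
    by (simp_all only: u_def v_def w_def flip: v')
  have "bar (bar v) = (bar (bar x) - x) / 2" and bu: "bar (bar u) = u" and bw: "bar (bar w) = w"
    by (simp_all add: u_def v_def w_def add.commute)
  then have bv: "bar (bar v) = - v"
    by (simp only: v_def minus_divide_left minus_diff_eq)
  show ?thesis
  proof (cases "v = 0")
    case True
    then show ?thesis
      using eq xy bu bw by (simp add: \<Phi>_fixed)
  next
    case False
    have "bar u = bar w"
    proof (rule twisted_cubic_injective[where \<nu> = "(bar v)^2" and \<mu> = "bar v * bar (bar v)"])
      show "(bar u)^2 \<noteq> (bar v)^2" "(bar w)^2 \<noteq> (bar v)^2"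
        using \<Phi>_decomposition(1)[OF bv False] bu bw by blast+
      show "((bar u)\<^sup>2 * bar (bar u) + 3 * (bar v)\<^sup>2 * bar (bar u) - 4 * (bar v * bar (bar v)) * bar u) /
          ((bar u)\<^sup>2 - (bar v)\<^sup>2) =
          ((bar w)\<^sup>2 * bar (bar w) + 3 * (bar v)\<^sup>2 * bar (bar w) - 4 * (bar v * bar (bar v)) * bar w) /
          ((bar w)\<^sup>2 - (bar v)\<^sup>2)"
        using eq \<Phi>_decomposition(2)[OF bv False bu] \<Phi>_decomposition(2)[OF bv False bw] xy
        by simp
    qed (use bv bu bw False in \<open>simp_all add: power2_eq_square\<close>)
    then have "bar (bar u) = bar (bar w)"
      by simp
    then show ?thesis
      using bu bw xy by simp
  qed
qed

text \<open>The usual witness \<open>1 + bar (bar s)\<close> vanishes exactly for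
  \<open>s = - 1\<close>; there \<open>c\<close> supplies a nonzero element negated by
  \<open>bar\<close> applied twice.\<close>

lemma hilbert90:
  assumes c: "bar (bar c) \<noteq> c" and s: "s * bar (bar s) = 1"
  obtains x where "x \<noteq> 0" "bar (bar x) = s * x"
proof (cases "s = - 1")
  case True
  with c that[of "c - bar (bar c)"] show ?thesis
    by simp
next
  case False
  then have "1 + bar (bar s) \<noteq> 0"
    using s by (metis add_eq_0_iff mult_minus1_right neg_equal_iff_equal add.inverse_inverse)
  moreover have "bar (bar (1 + bar (bar s))) = s * (1 + bar (bar s))"
    using s by (simp add: algebra_simps)
  ultimately show ?thesis
    using that by blast
qed

text \<open>The denominator is \<open>\<Phi> x\<close> up to a nonzero factor, so it cannot vanish,
  by injectivity of \<open>\<Phi>\<close> and \<open>\<Phi> 0 = 0\<close>.\<close>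

lemma \<Phi>_quotient:
  assumes x: "x \<noteq> 0" "bar (bar x) = s * x"
  defines "r \<equiv> bar s"
  shows "s * r^2 - r + 1 \<noteq> 0"
    and "bar (bar (\<Phi> x)) / \<Phi> x = (s * r^2 - s * r + 1) / (s * r^2 - r + 1)"
proof -
  have "s \<noteq> 0"
    using x by (metis bar_eq_0_iff mult_zero_left)
  then have r0: "r \<noteq> 0"
    by (simp add: r_def)
  have \<Phi>x: "\<Phi> x = x - (s * x * r + x / r)"
    using x r0 by (simp add: \<Phi>_def flip: r_def)
  have 1: "\<Phi> x = - (x / r) * (s * r^2 - r + 1)"
    unfolding \<Phi>x using r0 by (simp add: field_simps power2_eq_square)
  have 2: "bar (bar (\<Phi> x)) = - (x / r) * (s * r^2 - s * r + 1)"
    unfolding bar2_\<Phi> x(2) unfolding \<Phi>x using r0 by (simp add: field_simps power2_eq_square)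
  have "\<Phi> x \<noteq> 0"
    using \<Phi>_injective[of x 0] x by auto
  then show "s * r^2 - r + 1 \<noteq> 0"
    using 1 by auto
  show "bar (bar (\<Phi> x)) / \<Phi> x = (s * r^2 - s * r + 1) / (s * r^2 - r + 1)"
    unfolding 2 unfolding 1 using x r0 by simp
qed

lemma unit_circle_permutation:
  assumes c: "bar (bar c) \<noteq> c" and fin: "finite (UNIV :: 'a set)"
  shows "quotient_permutes (\<lambda>s. s * (bar s)^2 - s * bar s + 1) (\<lambda>s. s * (bar s)^2 - bar s + 1)
    {s. s * bar (bar s) = 1}"
    (is "quotient_permutes ?g ?h ?S")
  unfolding quotient_permutes_def
proof (intro conjI ballI)
  fix s assume "s \<in> ?S"
  then obtain x where "x \<noteq> 0" "bar (bar x) = s * x"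
    using hilbert90[OF c] by blast
  then show "?h s \<noteq> 0"
    by (rule \<Phi>_quotient)
next
  have "(\<lambda>s. ?g s / ?h s) ` ?S \<subseteq> ?S"
  proof safe
    fix s assume "s * bar (bar s) = 1"
    then obtain x where x: "x \<noteq> 0" "bar (bar x) = s * x"
      using hilbert90[OF c] by blast
    have "\<Phi> x \<noteq> 0"
      using \<Phi>_injective[of x 0] x by auto
    then show "?g s / ?h s * bar (bar (?g s / ?h s)) = 1"
      unfolding \<Phi>_quotient(2)[OF x, symmetric] by simp
  qed
  moreover have "inj_on (\<lambda>s. ?g s / ?h s) ?S"
  proof (rule inj_onI, unfold mem_Collect_eq)
    fix s t assume "s * bar (bar s) = 1" "t * bar (bar t) = 1" and eq: "?g s / ?h s = ?g t / ?h t"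
    then obtain x y where x: "x \<noteq> 0" "bar (bar x) = s * x" and y: "y \<noteq> 0" "bar (bar y) = t * y"
      using hilbert90[OF c] by metis
    have nz: "\<Phi> x \<noteq> 0" "\<Phi> y \<noteq> 0"
      using \<Phi>_injective[of x 0] \<Phi>_injective[of y 0] x y by auto
    \<comment> \<open>Equal images make this ratio a scalar for which \<open>\<Phi>\<close> is
      homogeneous, whence \<open>y = k * x\<close>.\<close>
    define k where "k = \<Phi> y / \<Phi> x"
    have "bar (bar (\<Phi> x)) / \<Phi> x = bar (bar (\<Phi> y)) / \<Phi> y"
      unfolding \<Phi>_quotient(2)[OF x] \<Phi>_quotient(2)[OF y] by (rule eq)
    then have k: "bar (bar k) = k"
      using nz by (simp add: k_def field_simps)
    have "\<Phi> (k * x) = \<Phi> y"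
      using nz by (simp add: \<Phi>_scale[OF k]) (simp add: k_def)
    then have "y = k * x"
      using \<Phi>_injective by blast
    with x y k show "s = t"
      by (simp add: mult_ac)
  qed
  ultimately show "bij_betw (\<lambda>s. ?g s / ?h s) ?S ?S"
    using finite_subset[OF subset_UNIV fin] by (simp add: bij_betw_def endo_inj_surj)
qed

end

section \<open>Finite fields and the \<open>Q\<close>-th power map\<close>

lemma of_nat_CARD_eq_0: "of_nat CARD('a) = (0 :: 'a::finite_field)"
proof -
  \<comment> \<open>Translation by \<open>1\<close> permutes the field.\<close>
  have "(\<Sum>x\<in>UNIV. x :: 'a) = (\<Sum>x\<in>UNIV. x + 1)"
    by (rule sum.reindex_bij_witness[of _ "\<lambda>x. x + 1" "\<lambda>x. x - 1"]) auto
  then show ?thesis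
    by (simp add: sum.distrib)
qed

lemma field_endomorphism_power:
  assumes Q: "primepow Q" "odd Q" and card: "CARD('a::finite_field) = Q ^ n"
  shows "field_endomorphism (\<lambda>x::'a. x ^ Q)"
proof -
  obtain p k where p: "prime p" "k > 0" "Q = p ^ k"
    using Q(1) by (auto simp: primepow_def)
  have "CHAR('a) dvd Q ^ n"
    using of_nat_CARD_eq_0[where 'a = 'a] card by (simp only: of_nat_eq_0_iff_char_dvd)
  then have "CHAR('a) dvd p"
    using p(3) by (metis CHAR_prime prime_dvd_power)
  then have char: "CHAR('a) = p"
    using p(1) by (metis CHAR_prime primes_dvd_imp_eq)
  show ?thesis
  proof
    show "(x + y) ^ Q = x ^ Q + y ^ Q" for x y :: 'a
      using p(3) by (intro freshmans_dream'[where n = k]) (simp_all add: char p(1))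
    have "\<not> p dvd 2"
      using p Q(2) by (metis dvd_refl even_power primes_dvd_imp_eq two_is_prime_nat)
    then show "(2::'a) \<noteq> 0"
      using of_nat_eq_0_iff_char_dvd[where 'a = 'a, of 2] char by simp
  qed (simp_all add: power_mult_distrib)
qed

text \<open>Half of Euler's criterion, by counting: squaring is at most two-to-one, so there are at
  least \<open>h\<close> nonzero squares, all roots of \<open>X^h - 1\<close>; a nonsquare root
  would be one too many.\<close>

lemma nonsquare_power_half:
  fixes \<nu> :: "'a::finite_field"
  assumes card: "CARD('a) = 2 * h + 1" and \<nu>: "\<nexists>y. \<nu> = y ^ 2"
  shows "\<nu> ^ h = - 1"
proof -
  have pow1: "x ^ (2 * h) = 1" if "x \<noteq> 0" for x :: 'a
    using finite_field_power_card_eq_same[of x] that by (simp add: card)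
  have "\<nu> \<noteq> 0"
    using \<nu> by (metis zero_power2)
  then have "(\<nu> ^ h) ^ 2 = 1"
    using pow1 by (simp flip: power_mult add: mult.commute)
  moreover have "\<nu> ^ h \<noteq> 1"
  proof
    assume "\<nu> ^ h = 1"
    define T where "T = (\<lambda>x::'a. x ^ 2) ` (UNIV - {0})"
    define S where "S = {x::'a. x ^ h = 1}"
    have "CARD('a) > 1"
      using card_mono[of "UNIV::'a set" "{0, 1}"] by simp
    then have "h > 0"
      using card by simp
    have "insert \<nu> T \<subseteq> S"
      using \<open>\<nu> ^ h = 1\<close> pow1 by (auto simp: S_def T_def simp flip: power_mult)
    moreover have "\<nu> \<notin> T"
      using \<nu> by (auto simp: T_def)
    ultimately have "Suc (card T) \<le> card S"
      by (metis card_insert_disjoint card_mono finite)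
    also have "card S \<le> h"
    proof -
      have "monom 1 h - 1 \<noteq> (0 :: 'a poly)" "degree (monom 1 h - 1 :: 'a poly) \<le> h"
        using \<open>h > 0\<close> by (auto simp: poly_eq_iff degree_monom_eq intro!: degree_diff_le exI[of _ h])
      then show ?thesis
        using card_poly_roots_bound[of "monom 1 h - 1 :: 'a poly"]
        by (simp add: S_def poly_monom)
    qed
    finally have "card T < h"
      by simp
    have "2 * h = card (UNIV - {0::'a})"
      by (simp add: card)
    also have "\<dots> \<le> card (\<Union>t\<in>T. {x. x ^ 2 = t})"
      by (rule card_mono) (auto simp: T_def)
    also have "\<dots> \<le> (\<Sum>t\<in>T. card {x. x ^ 2 = t})"
      by (rule card_UN_le) simp
    also have "\<dots> \<le> (\<Sum>t\<in>T. 2)"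
    proof (rule sum_mono)
      fix t assume "t \<in> T"
      then obtain y where "t = y ^ 2"
        by (auto simp: T_def)
      then have "{x. x ^ 2 = t} = {y, - y}"
        by (auto simp: power2_eq_iff)
      then show "card {x. x ^ 2 = t} \<le> 2"
        by (simp add: card_insert_if)
    qed
    finally show False
      using \<open>card T < h\<close> by simp
  qed
  ultimately show ?thesis
    by (simp add: power2_eq_1_iff)
qed

lemma quartic_automorphism_power:
  assumes "primepow Q" "odd Q" and card: "CARD('a::finite_field) = Q ^ 4"
  shows "quartic_automorphism (\<lambda>x::'a. x ^ Q)"
proof -
  interpret field_endomorphism "\<lambda>x::'a. x ^ Q"
    using assms by (rule field_endomorphism_power)
  show ?thesis
  proof
    show "(((x ^ Q) ^ Q) ^ Q) ^ Q = x" for x :: 'a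
      using finite_field_power_card_eq_same[of x]
      by (simp add: card eval_nat_numeral mult_ac flip: power_mult)
  qed
qed

text \<open>For \<open>x \<noteq> 0\<close> the subtraction in the exponent becomes division by
  \<open>x ^ Q\<close>. At \<open>0\<close> the positive exponent gives \<open>0\<close>, in
  agreement with \<open>a / 0 = 0\<close>.\<close>

lemma poly_F6:
  assumes "primepow Q" "odd Q" and card: "CARD('a::finite_field) = Q ^ 4"
  shows "poly (F6 Q) = quartic_automorphism.\<Phi> (\<lambda>x::'a. x ^ Q)"
proof
  fix x :: 'a
  note quartic = quartic_automorphism_power[OF assms]
  have "Q > 0"
    using assms(2) by (rule odd_pos)
  define E where "E = x ^ (Q ^ 3 + Q ^ 2 - Q)"
  have F6: "poly (F6 Q) x = x - ((E ^ Q) ^ Q + E)"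
    by (simp add: F6_def trace_poly_def poly_pcompose poly_monom E_def power2_eq_square mult_ac
        flip: power_mult)
  show "poly (F6 Q) x = quartic_automorphism.\<Phi> (\<lambda>x. x ^ Q) x"
  proof (cases "x = 0")
    case True
    have "Q ^ 3 + Q ^ 2 - Q > 0"
    proof -
      have "Q \<le> Q ^ 2" "Q ^ 3 > 0"
        using \<open>Q > 0\<close> by (simp_all add: power2_eq_square)
      then show ?thesis
        by linarith
    qed
    with True show ?thesis
      using \<open>Q > 0\<close> F6 by (simp add: E_def power_0_left quartic_automorphism.\<Phi>_0[OF quartic])
  next
    case False
    have "E * x ^ Q = x ^ (Q ^ 3 + Q ^ 2)"
      using \<open>Q > 0\<close> by (simp add: E_def power2_eq_square trans_le_add2 flip: power_add)
    also have "\<dots> = (x ^ Q) ^ Q * ((x ^ Q) ^ Q) ^ Q"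
      by (simp add: eval_nat_numeral power_add mult_ac flip: power_mult)
    finally have E: "E = (x ^ Q) ^ Q * ((x ^ Q) ^ Q) ^ Q / x ^ Q"
      using False by (simp add: eq_divide_eq)
    then have "(E ^ Q) ^ Q = x * x ^ Q / ((x ^ Q) ^ Q) ^ Q"
      by (simp only: power_divide power_mult_distrib quartic_automorphism.bar4[OF quartic])
    then show ?thesis
      unfolding F6 quartic_automorphism.\<Phi>_def[OF quartic] using E by (simp only: add.commute)
  qed
qed

text \<open>\<open>X^n - X\<close> has at most \<open>n\<close> roots. This yields the element
  \<open>c\<close> that \<open>hilbert90\<close> requires.\<close>

lemma ex_power_neq_self:
  assumes "n > 1" and card: "CARD('a::finite_field) > n"
  shows "\<exists>c::'a. c ^ n \<noteq> c"
proof (rule ccontr)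
  assume "\<not> ?thesis"
  then have "card {x::'a. poly (monom 1 n - monom 1 1) x = 0} = CARD('a)"
    by (simp add: poly_monom)
  moreover have "monom 1 n - monom 1 1 \<noteq> (0 :: 'a poly)"
    using \<open>n > 1\<close> by (auto simp: poly_eq_iff)
  moreover have "degree (monom 1 n - monom 1 1 :: 'a poly) \<le> n"
    using \<open>n > 1\<close> by (intro degree_diff_le) (simp_all add: degree_monom_eq)
  ultimately show False
    using card_poly_roots_bound[of "monom 1 n - monom 1 1 :: 'a poly"] card by simp
qed

section \<open>The three permutations\<close>

theorem theorem7p1:
  fixes Q :: nat
  assumes "primepow Q" and "odd Q"
  shows
    "(CARD('a::finite_field) = Q ^ 4 \<longrightarrow>
        bij_betw (poly (F6 Q)) (UNIV :: 'a set) UNIV) \<and>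
     (CARD('b::finite_field) = Q ^ 2 \<longrightarrow>
        (\<forall>\<nu>::'b. (\<nexists>y. \<nu> = y ^ 2) \<longrightarrow>
          quotient_permutes
            (\<lambda>x. x ^ (Q + 2) + 3 * \<nu> * x ^ Q - 4 * \<nu> ^ ((Q + 1) div 2) * x)
            (\<lambda>x. x ^ 2 - \<nu>)
            UNIV)) \<and>
     (CARD('a) = Q ^ 4 \<longrightarrow>
        quotient_permutes
          (\<lambda>x. x ^ (2 * Q + 1) - x ^ (Q + 1) + 1)
          (\<lambda>x. x ^ (2 * Q + 1) - x ^ Q + 1)
          {x::'a. x ^ (Q ^ 2 + 1) = 1})"
proof (intro conjI impI allI)
  assume card: "CARD('a) = Q ^ 4"
  note quartic = quartic_automorphism_power[OF assms card]
  have "inj (quartic_automorphism.\<Phi> (\<lambda>x::'a. x ^ Q))"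
    by (rule injI) (rule quartic_automorphism.\<Phi>_injective[OF quartic])
  then show "bij_betw (poly (F6 Q)) (UNIV :: 'a set) UNIV"
    unfolding poly_F6[OF assms card]
    by (simp add: bij_betw_def finite_UNIV_inj_surj)
next
  fix \<nu> :: 'b
  assume card: "CARD('b) = Q ^ 2" and \<nu>: "\<nexists>y. \<nu> = y ^ 2"
  note endo = field_endomorphism_power[OF assms card]
  have bar2: "(x ^ Q) ^ Q = x" for x :: 'b
    using finite_field_power_card_eq_same[of x]
    by (simp add: card power2_eq_square flip: power_mult)
  have neq: "x ^ 2 \<noteq> \<nu>" for x
    using \<nu> by blast
  then have "\<nu> \<noteq> 0"
    by (metis zero_power2)
  define \<mu> where "\<mu> = \<nu> ^ ((Q + 1) div 2)"
  obtain j where j: "Q = 2 * j + 1"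
    using assms(2) by (rule oddE)
  have "\<mu> ^ 2 = \<nu> * \<nu> ^ Q"
  proof -
    have "\<mu> ^ 2 = \<nu> ^ ((Q + 1) div 2 * 2)"
      by (simp only: \<mu>_def power_mult)
    also have "(Q + 1) div 2 * 2 = Suc Q"
      by (simp add: j)
    finally show ?thesis
      by simp
  qed
  \<comment> \<open>The exponent is \<open>(Q^2 - 1) / 2\<close>, and also \<open>(Q - 1)\<close>
    times the exponent \<open>(Q + 1) / 2\<close> in \<open>\<mu>\<close>; hence
    \<open>\<mu> ^ (Q - 1) = - 1\<close>.\<close>
  have "\<nu> ^ (j * (Q + 1)) = - 1"
    by (rule nonsquare_power_half[OF _ \<nu>]) (simp add: card j power2_eq_square algebra_simps)
  then have "\<mu> ^ Q = - \<mu>"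
    by (simp add: \<mu>_def j algebra_simps power_add flip: power_mult)
  have "inj (\<lambda>x. (x ^ (Q + 2) + 3 * \<nu> * x ^ Q - 4 * \<mu> * x) / (x ^ 2 - \<nu>))"
  proof (rule injI)
    fix x y assume eq: "(x ^ (Q + 2) + 3 * \<nu> * x ^ Q - 4 * \<mu> * x) / (x ^ 2 - \<nu>) =
      (y ^ (Q + 2) + 3 * \<nu> * y ^ Q - 4 * \<mu> * y) / (y ^ 2 - \<nu>)"
    have pow: "z ^ (Q + 2) = z ^ 2 * z ^ Q" for z :: 'b
      by (simp only: power_add mult.commute)
    show "x = y"
      by (rule field_endomorphism.twisted_cubic_injective[OF endo bar2 bar2 bar2 \<open>\<nu> \<noteq> 0\<close>
            \<open>\<mu> ^ 2 = \<nu> * \<nu> ^ Q\<close> \<open>\<mu> ^ Q = - \<mu>\<close> neq neq eq[unfolded pow]])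
  qed
  then show "quotient_permutes
            (\<lambda>x. x ^ (Q + 2) + 3 * \<nu> * x ^ Q - 4 * \<nu> ^ ((Q + 1) div 2) * x)
            (\<lambda>x. x ^ 2 - \<nu>) UNIV"
    unfolding quotient_permutes_def \<mu>_def[symmetric]
    using neq by (simp add: bij_betw_def finite_UNIV_inj_surj)
next
  assume card: "CARD('a) = Q ^ 4"
  note quartic = quartic_automorphism_power[OF assms card]
  have "Q > 1"
    using assms(1) primepow_gt_Suc_0 by simp
  then have "1 < Q ^ 2" "Q ^ 2 < CARD('a)"
    unfolding card by (intro one_less_power power_strict_increasing; simp)+
  then obtain c :: 'a where "c ^ (Q ^ 2) \<noteq> c"
    using ex_power_neq_self by blast
  then have c: "(c ^ Q) ^ Q \<noteq> c"
    by (simp add: power2_eq_square flip: power_mult)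
  have pow: "x ^ (2 * Q + 1) = x * (x ^ Q) ^ 2" "x ^ (Q + 1) = x * x ^ Q"
      "x ^ (Q ^ 2 + 1) = x * (x ^ Q) ^ Q" for x :: 'a
    by (simp_all add: power2_eq_square mult_2 power_add power_mult)
  show "quotient_permutes
          (\<lambda>x. x ^ (2 * Q + 1) - x ^ (Q + 1) + 1)
          (\<lambda>x. x ^ (2 * Q + 1) - x ^ Q + 1)
          {x::'a. x ^ (Q ^ 2 + 1) = 1}"
    unfolding pow by (rule quartic_automorphism.unit_circle_permutation[OF quartic c finite])
qed

end
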